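(* Let $m\in\mathbb{N}$ and $L,T,\lambda_1,\dots,\lambda_{m+1}\in\mathbb{R}_{>0}$. Let $M\in[0,L]$, and consider the $m$th order implicit robust exact differentiator $\mathcal{D}^{(m)}_T$ with these parameters (defined in the context) with input $u_k=f(kT)+\eta_k$, where $f\in\mathcal{F}^{(m)}_M$ and $(\eta_k)$ is a real-valued sequence. Suppose that $K\in\mathbb{N}$ exists such that for all $k\ge K$, $\eta_k=0$ holds and the differentiator is in discrete-time sliding mode at time index $k$, i.e., such that $z_{1,k+1}=u_k=f(kT)$ holds for all $k\ge K$. Then the differentiator's outputs satisfy $$|y_{i,k}-f^{(i)}(kT)|\le c_{i,m+1}\,M\,T^{m-i+1}$$ for all $i=1,\dots,m$ and all $k\ge K+m+1$. Moreover, if $f(t)=M\frac{t^{m+1}}{(m+1)!}$, then the previous statement holds with equality in this inequality.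
   Context: Notation: $\mathbb{N}=\{1,2,\dots\}$. For $y,p\in\mathbb{R}$ with $p\neq0$, $\lfloor y\rceil^{p}=|y|^p\operatorname{sign}(y)$; $\lfloor y\rceil^0$ is the set-valued sign: $\lfloor y\rceil^0=\{\operatorname{sign}(y)\}$ for $y\ne0$ and $\lfloor 0\rceil^0=[-1,1]$. Sums and products of scalars and sets are taken elementwise. Signals: for $M\ge0$, $\mathcal{F}^{(m)}_M$ is the set of $m$ times differentiable functions $f:\mathbb{R}_{\ge0}\to\mathbb{R}$ whose $m$th derivative $f^{(m)}$ is Lipschitz continuous and satisfies $|f^{(m+1)}(t)|\le M$ for almost every $t\ge0$. Constants: $c_{i,j}$ for $i,j\in\mathbb{N}$ are defined by $c_{i,j}=\frac{(j-1)c_{i,j-1}+i\,c_{i-1,j-1}}{j}$ with $c_{0,0}=1$ and $c_{0,j}=c_{i,0}=0$ for $i,j\neq0$. Differentiator: the $m$th order implicit robust exact differentiator $\mathcal{D}^{(m)}_T$ with sampling time $T$ and parameters $L,\lambda_1,\dots,\lambda_{m+1}>0$ has state $(z_{1,k},\dots,z_{m+1,k})\in\mathbb{R}^{m+1}$, initial values $z_{1,1},\dots,z_{m+1,1}\in\mathbb{R}$, and maps an input sequence $(u_k)$ to outputs $y_{1,k},\dots,y_{m,k}$ via the implicit relations, for $k\ge1$, $$z_{i,k+1}=z_{i,k}+T\lambda_iL^{\frac{i}{m+1}}\lfloor u_k-z_{1,k+1}\rceil^{\frac{m-i+1}{m+1}}+Tz_{i+1,k+1}\quad(i=1,\dots,m),$$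 $$z_{m+1,k+1}\in z_{m+1,k}+T\lambda_{m+1}L\lfloor u_k-z_{1,k+1}\rceil^0,$$ $$y_{i,k}=\sum_{j=i}^{m}T^{j-i}c_{i,j}z_{j+1,k+1}\quad(i=1,\dots,m).$$ For every initial value and input these relations have a unique solution. The differentiator is said to be in discrete-time sliding mode at time index $k$ if the set on the right-hand side of the inclusion contains more than one element, i.e. if $z_{1,k+1}=u_k$. *)

theory Defs
  imports "HOL-Analysis.Analysis"
begin

text \<open>
  A function on the nonnegative reals is represented by a total function
  \<^typ>\<open>real \<Rightarrow> real\<close> whose values on the negative half-line are irrelevant.
  Accordingly all derivatives are taken within \<^term>\<open>{0::real..}\<close>: one-sided at 0,
  ordinary two-sided derivatives at every positive time.
\<close>

primrec nth_deriv :: "nat \<Rightarrow> (real \<Rightarrow> real) \<Rightarrow> real \<Rightarrow> real" where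
  "nth_deriv 0 f = f"
| "nth_deriv (Suc n) f = (\<lambda>t. vector_derivative (nth_deriv n f) (at t within {0..}))"

text \<open>
  \<^term>\<open>vector_derivative\<close> is an unspecified value where no derivative exists, so the
  almost-everywhere existence of the derivative of order \<open>m + 1\<close> (automatic by
  Lipschitz continuity) is made part of the almost-everywhere bound.
\<close>

definition signal_class :: "nat \<Rightarrow> real \<Rightarrow> (real \<Rightarrow> real) set" where
  "signal_class m M = {f.
     (\<forall>n<m. nth_deriv n f differentiable_on {0..}) \<and>
     (\<exists>C. C-lipschitz_on {0..} (nth_deriv m f)) \<and>
     (AE t in lborel. t \<ge> 0 \<longrightarrow>
        nth_deriv m f differentiable (at t within {0..}) \<and>
        \<bar>nth_deriv (Suc m) f t\<bar> \<le> M)}"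

fun diff_coeff :: "nat \<Rightarrow> nat \<Rightarrow> real" where
  "diff_coeff 0 0 = 1"
| "diff_coeff 0 (Suc j) = 0"
| "diff_coeff (Suc i) 0 = 0"
| "diff_coeff (Suc i) (Suc j) =
     (real j * diff_coeff (Suc i) j + real (Suc i) * diff_coeff i j) / real (Suc j)"

text \<open>
  The signed power \<open>\<lfloor>y\<rceil>\<^sup>p\<close> is single-valued for nonzero \<open>p\<close>;
  the exponent zero has its own, set-valued version.
\<close>

definition signed_pow :: "real \<Rightarrow> real \<Rightarrow> real" where
  "signed_pow y p = \<bar>y\<bar> powr p * sgn y"

definition sign_set :: "real \<Rightarrow> real set" where
  "sign_set y = (if y = 0 then {-1..1} else {sgn y})"

text \<open>
  Parameters are \<open>lam i\<close> for \<open>1 \<le> i \<le> m + 1\<close>, and \<open>z i k\<close> is the \<open>i\<close>-th state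
  component (\<open>1 \<le> i \<le> m + 1\<close>) at time index \<open>k \<ge> 1\<close>; all other values are irrelevant.
  The initial values \<open>z i 1\<close> are unconstrained.
\<close>

definition ired_rhs ::
  "nat \<Rightarrow> real \<Rightarrow> real \<Rightarrow> (nat \<Rightarrow> real) \<Rightarrow> (nat \<Rightarrow> real) \<Rightarrow> (nat \<Rightarrow> nat \<Rightarrow> real) \<Rightarrow> nat \<Rightarrow> real set"
where
  "ired_rhs m T L lam u z k =
     (\<lambda>s. z (m + 1) k + T * lam (m + 1) * L * s) ` sign_set (u k - z 1 (k + 1))"

definition ired_trajectory ::
  "nat \<Rightarrow> real \<Rightarrow> real \<Rightarrow> (nat \<Rightarrow> real) \<Rightarrow> (nat \<Rightarrow> real) \<Rightarrow> (nat \<Rightarrow> nat \<Rightarrow> real) \<Rightarrow> bool"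
where
  "ired_trajectory m T L lam u z \<longleftrightarrow>
     (\<forall>k\<ge>1.
        (\<forall>i\<in>{1..m}.
           z i (k + 1) = z i k
             + T * lam i * L powr (real i / real (m + 1))
                 * signed_pow (u k - z 1 (k + 1)) (real (m - i + 1) / real (m + 1))
             + T * z (i + 1) (k + 1)) \<and>
        z (m + 1) (k + 1) \<in> ired_rhs m T L lam u z k)"

definition ired_output :: "nat \<Rightarrow> real \<Rightarrow> (nat \<Rightarrow> nat \<Rightarrow> real) \<Rightarrow> nat \<Rightarrow> nat \<Rightarrow> real" where
  "ired_output m T z i k = (\<Sum>j=i..m. T ^ (j - i) * diff_coeff i j * z (j + 1) (k + 1))"

definition sliding_mode ::
  "nat \<Rightarrow> real \<Rightarrow> real \<Rightarrow> (nat \<Rightarrow> real) \<Rightarrow> (nat \<Rightarrow> real) \<Rightarrow> (nat \<Rightarrow> nat \<Rightarrow> real) \<Rightarrow> nat \<Rightarrow> bool"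
where
  "sliding_mode m T L lam u z k \<longleftrightarrow>
     (\<exists>a\<in>ired_rhs m T L lam u z k. \<exists>b\<in>ired_rhs m T L lam u z k. a \<noteq> b)"

lemma sliding_mode_iff:
  assumes "T > 0" "L > 0" "lam (m + 1) > 0"
  shows "sliding_mode m T L lam u z k \<longleftrightarrow> z 1 (k + 1) = u k"
proof
  assume "z 1 (k + 1) = u k"
  then have "ired_rhs m T L lam u z k =
      (\<lambda>s. z (m + 1) k + T * lam (m + 1) * L * s) ` {-1..1}"
    by (simp add: ired_rhs_def sign_set_def)
  moreover have "z (m + 1) k + T * lam (m + 1) * L * 0 \<noteq> z (m + 1) k + T * lam (m + 1) * L * 1"
    using assms by simp
  moreover have "(0::real) \<in> {-1..1}" "(1::real) \<in> {-1..1}"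
    by auto
  ultimately show "sliding_mode m T L lam u z k"
    unfolding sliding_mode_def by (metis imageI)
qed (auto simp: sliding_mode_def ired_rhs_def sign_set_def split: if_splits)

end

(*
  In sliding mode the state is z_{j+1,k+1} = nabla^j f(kT) / T^j, and c_{i,j} is the i-th
  derivative at 0 of the Newton basis polynomial N_j(s) = s (s+1) ... (s+j-1) / j!. Hence, in
  the variable s = t/T - k, the output y_{i,k} is T^(-i) times the i-th derivative at s = 0 of
  the polynomial P interpolating g(s) = f((k+s)T) at s = 0, -1, ..., -m.
  Choose c such that E = g - P - c N_{m+1} satisfies E^(i)(0) = 0. Since E vanishes at all m+1
  nodes, i-fold application of Rolle's theorem gives m+1-i zeros of E^(i) that are negative;
  together with the zero at 0, the (m-i)-fold application gives two zeros of E^(m).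
  As the m-th derivative of P + c N_{m+1} is affine with slope c, this exhibits c as a
  difference quotient of g^(m), so |c| <= M T^(m+1), with c = M T^(m+1) for the monomial.
*)

theory Submission
  imports Defs "HOL-Computational_Algebra.Polynomial"
begin

section \<open>Mean value inequality from a derivative bound almost everywhere\<close>

text \<open>
  Cover the exceptional null set by an open set \<open>U\<close> of small measure: outside it
  increments are controlled by the derivative, inside it by the Lipschitz constant, the latter
  costing at most \<open>B\<close> times the measure of \<open>U\<close>.
\<close>

lemma lipschitz_AE_derivative_bound:
  fixes h :: "real \<Rightarrow> 'a::real_normed_vector"
  assumes "a \<le> b" and lip: "C-lipschitz_on {a..b} h"
    and deriv: "AE t in lborel. t \<in> {a..b} \<longrightarrow>
      (\<exists>D. (h has_vector_derivative D) (at t within {a..b}) \<and> norm D \<le> M)"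
  shows "norm (h b - h a) \<le> M * (b - a)"
proof -
  \<comment> \<open>This makes \<open>C \<le> M + e + B\<close> for every positive \<open>e\<close>,
    so the Lipschitz bound on an interval inside \<open>U\<close> has the same shape as the bound
    outside \<open>U\<close>.\<close>
  define B where "B = C + \<bar>M\<bar>"
  have B: "B \<ge> 0" using lipschitz_on_nonneg[OF lip] by (simp add: B_def)
  obtain N where N: "N \<in> null_sets lborel"
    and bad: "{t \<in> space lborel. \<not> (t \<in> {a..b} \<longrightarrow>
      (\<exists>D. (h has_vector_derivative D) (at t within {a..b}) \<and> norm D \<le> M))} \<subseteq> N"
    using deriv unfolding eventually_ae_filter by blast
  then have good: "\<And>t. t \<in> {a..b} \<Longrightarrow> t \<notin> N \<Longrightarrow>
      \<exists>D. (h has_vector_derivative D) (at t within {a..b}) \<and> norm D \<le> M"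
    by auto
  have approx: "norm (h b - h a) \<le> (M + e) * (b - a) + B * e" if e: "e > 0" for e
  proof -
    have "N \<in> sets borel" using N by auto
    from outer_regular_lborel[OF this e] obtain U
      where U: "open U" "N \<subseteq> U" and UN: "emeasure lborel (U - N) < ennreal e"
      by blast
    have mU: "emeasure lborel U < ennreal e"
      using UN N U(1) by (simp add: emeasure_Diff_null_set)
    \<comment> \<open>Applied to half-open intervals, which are disjoint when adjacent, so that
      \<open>\<mu>\<close> is additive under subdivision.\<close>
    define \<mu> where "\<mu> S = measure lborel (U \<inter> S)" for S :: "real set"
    have fin: "emeasure lborel (U \<inter> S) < \<infinity>" if "S \<in> sets borel" for S
    proof -
      have "emeasure lborel (U \<inter> S) \<le> emeasure lborel U"
        using U(1) that by (intro emeasure_mono) auto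
      also have "\<dots> < \<infinity>" using mU by (auto intro: less_trans)
      finally show ?thesis .
    qed
    \<comment> \<open>The claim is additive over adjacent intervals, so bisection reduces it to all
      short intervals around one point \<open>x\<close>. Off \<open>N\<close> the derivative at
      \<open>x\<close> controls them; otherwise they lie inside \<open>U\<close>.\<close>
    have bound: "norm (h d - h c) \<le> (M + e) * (d - c) + B * \<mu> {c<..d}"
      if "c \<le> d" "{c..d} \<subseteq> {a..b}" for c d
      using that
    proof (induction c d rule: Bolzano)
      case (trans p q r)
      have "\<mu> {p<..r} = \<mu> {p<..q} + \<mu> {q<..r}"
      proof -
        have *: "U \<inter> {p<..r} = (U \<inter> {p<..q}) \<union> (U \<inter> {q<..r})"
          using trans by auto
        show ?thesis
          unfolding \<mu>_def * using U(1) fin[of "{p<..q}"] fin[of "{q<..r}"]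
          by (intro measure_Union) auto
      qed
      moreover have "norm (h r - h p) \<le> norm (h q - h p) + norm (h r - h q)"
        by (metis add.commute diff_add_cancel norm_triangle_ineq add_diff_eq)
      moreover have "norm (h q - h p) \<le> (M + e) * (q - p) + B * \<mu> {p<..q}"
        using trans by auto
      moreover have "norm (h r - h q) \<le> (M + e) * (r - q) + B * \<mu> {q<..r}"
        using trans by auto
      ultimately show ?case by (simp add: algebra_simps)
    next
      case (local x)
      show ?case
      proof (cases "x \<in> {a..b} - N")
        case True
        then obtain D where D: "(h has_vector_derivative D) (at x within {a..b})" "norm D \<le> M"
          using good by blast
        then obtain \<delta> where \<delta>: "\<delta> > 0" and near: "\<And>y. y \<in> {a..b} \<Longrightarrow> norm (y - x) < \<delta> \<Longrightarrow>
            norm (h y - h x - (y - x) *\<^sub>R D) \<le> e * norm (y - x)"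
          using e unfolding has_vector_derivative_def has_derivative_within_alt by blast
        have near': "norm (h y - h x) \<le> (M + e) * \<bar>y - x\<bar>"
          if y: "y \<in> {a..b}" "\<bar>y - x\<bar> < \<delta>" for y
        proof -
          have "norm (h y - h x) \<le> norm (h y - h x - (y - x) *\<^sub>R D) + norm ((y - x) *\<^sub>R D)"
            by (metis diff_add_cancel norm_triangle_ineq)
          also have "\<dots> \<le> e * \<bar>y - x\<bar> + \<bar>y - x\<bar> * M"
            using near[of y] y D(2) by (intro add_mono) (auto intro: mult_left_mono)
          finally show ?thesis by (simp add: algebra_simps)
        qed
        have "norm (h q - h p) \<le> (M + e) * (q - p) + B * \<mu> {p<..q}"
          if pq: "p \<le> x" "x \<le> q" "q - p < \<delta>" "{p..q} \<subseteq> {a..b}" for p q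
        proof -
          have "norm (h q - h p) \<le> norm (h q - h x) + norm (h p - h x)"
            by (metis norm_triangle_ineq4 diff_diff_eq2 diff_add_cancel)
          also have "\<dots> \<le> (M + e) * \<bar>q - x\<bar> + (M + e) * \<bar>p - x\<bar>"
            using pq by (intro add_mono near') auto
          also have "\<dots> = (M + e) * (q - p)"
            using pq by (simp add: algebra_simps)
          finally show ?thesis using B by (simp add: \<mu>_def add_increasing2)
        qed
        then show ?thesis using \<delta> by blast
      next
        case False
        then have "x \<in> U" using U(2) local \<open>{c..d} \<subseteq> {a..b}\<close> by auto
        then obtain \<delta> where \<delta>: "\<delta> > 0" "ball x \<delta> \<subseteq> U"
          using U(1) open_contains_ball by blast
        have "norm (h q - h p) \<le> (M + e) * (q - p) + B * \<mu> {p<..q}"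
          if pq: "p \<le> x" "x \<le> q" "q - p < \<delta>" "{p..q} \<subseteq> {a..b}" for p q
        proof -
          have "{p<..q} \<subseteq> U" using pq \<delta> by (force simp: dist_real_def)
          then have \<mu>: "\<mu> {p<..q} = q - p" using pq by (simp add: \<mu>_def Int_absorb1)
          have "norm (h q - h p) \<le> C * (q - p)"
            using lipschitz_onD[OF lip, of q p] pq by (auto simp: dist_norm)
          moreover have "C \<le> M + e + B" using e unfolding B_def by linarith
          then have "C * (q - p) \<le> (M + e + B) * (q - p)"
            using pq(1,2) by (intro mult_right_mono) simp_all
          ultimately have "norm (h q - h p) \<le> (M + e) * (q - p) + B * (q - p)"
            using distrib_right[of "M + e" B "q - p"] by linarith
          then show ?thesis by (simp only: \<mu>)
        qed
        then show ?thesis using \<delta> by blast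
      qed
    qed
    have "\<mu> {a<..b} \<le> e"
    proof -
      have "emeasure lborel (U \<inter> {a<..b}) \<le> emeasure lborel U"
        using U(1) by (intro emeasure_mono) auto
      also have "\<dots> \<le> ennreal e" using mU by simp
      finally have "emeasure lborel (U \<inter> {a<..b}) \<le> ennreal e" .
      then show ?thesis
        using e by (auto simp: \<mu>_def measure_def intro: enn2real_leI)
    qed
    then have "B * \<mu> {a<..b} \<le> B * e" using B by (rule mult_left_mono)
    then show ?thesis using bound[of a b] \<open>a \<le> b\<close> by simp
  qed
  show ?thesis
  proof (rule field_le_epsilon)
    fix e :: real assume "e > 0"
    \<comment> \<open>Total error is \<open>e' * (b - a + B)\<close>; the summand \<open>1\<close>
      keeps the denominator positive.\<close>
    define e' where "e' = e / (b - a + B + 1)"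
    have "e' > 0" "e' * (b - a + B) \<le> e"
      using \<open>e > 0\<close> B \<open>a \<le> b\<close> by (simp_all add: e'_def pos_divide_le_eq add_nonneg_pos)
    then show "norm (h b - h a) \<le> M * (b - a) + e"
      using approx[of e'] by (simp add: algebra_simps)
  qed
qed

section \<open>Zeros of higher derivatives\<close>

text \<open>Each application of Rolle's theorem trades \<open>r + 1\<close> ordered zeros for
  \<open>r\<close> zeros strictly between them. After at least one application all zeros are
  therefore below \<open>b\<close>, which later allows the right endpoint to be appended as a
  further zero; for \<open>k = 0\<close> the last zero may still be \<open>b\<close>.\<close>

lemma iterated_Rolle:
  fixes F :: "nat \<Rightarrow> real \<Rightarrow> real" and x :: "nat \<Rightarrow> real"
  assumes "\<And>j t. j < k \<Longrightarrow> t \<in> {a..b} \<Longrightarrow> (F j has_real_derivative F (Suc j) t) (at t within {a..b})"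
    and "\<And>i. i < n \<Longrightarrow> x i < x (Suc i)"
    and "\<And>i. i \<le> n \<Longrightarrow> x i \<in> {a..b} \<and> F 0 (x i) = 0"
    and "k \<le> n"
  obtains y where "\<And>i. i < n - k \<Longrightarrow> y i < y (Suc i)"
    and "\<And>i. i \<le> n - k \<Longrightarrow> y i \<in> {a..b} \<and> F k (y i) = 0"
    and "\<And>i. 0 < k \<Longrightarrow> i \<le> n - k \<Longrightarrow> y i < b"
  using assms
proof (induction k arbitrary: thesis)
  case 0
  show ?case by (rule 0(1)[of x]) (use 0 in auto)
next
  case (Suc k)
  obtain y where y: "\<And>i. i < n - k \<Longrightarrow> y i < y (Suc i)"
    "\<And>i. i \<le> n - k \<Longrightarrow> y i \<in> {a..b} \<and> F k (y i) = 0"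
    using Suc.IH Suc.prems by (metis Suc_leD less_Suc_eq)
  have "\<exists>w. y i < w \<and> w < y (Suc i) \<and> F (Suc k) w = 0" if i: "i < n - k" for i
  proof -
    have sub: "{y i..y (Suc i)} \<subseteq> {a..b}" using y(2)[of i] y(2)[of "Suc i"] i by auto
    have der: "(F k has_real_derivative F (Suc k) t) (at t within {a..b})" if "t \<in> {a..b}" for t
      using Suc.prems(2) that by blast
    have cont: "continuous_on {y i..y (Suc i)} (F k)"
      using der sub by (meson DERIV_continuous_on continuous_on_subset)
    have "(F k has_derivative (*) (F (Suc k) t)) (at t)" if "y i < t" "t < y (Suc i)" for t
    proof -
      have "a < t" "t < b" using that y(2)[of i] y(2)[of "Suc i"] i by auto
      then show ?thesis using der[of t] at_within_Icc_at[of a t b]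
        by (simp add: has_field_derivative_def)
    qed
    from Rolle_deriv[OF y(1)[OF i] _ cont this] obtain w
      where "y i < w" "w < y (Suc i)" "(*) (F (Suc k) w) = (\<lambda>v. 0)"
      using y(2)[of i] y(2)[of "Suc i"] i by auto
    then show ?thesis by (metis mult.right_neutral)
  qed
  then obtain w where w: "\<And>i. i < n - k \<Longrightarrow> y i < w i \<and> w i < y (Suc i) \<and> F (Suc k) (w i) = 0"
    by metis
  show ?case
  proof (rule Suc.prems(1))
    show "w i < w (Suc i)" if "i < n - Suc k" for i
    proof -
      have "i < n - k" "Suc i < n - k" using that by auto
      from w[OF this(1)] w[OF this(2)] show ?thesis by linarith
    qed
    show "w i \<in> {a..b} \<and> F (Suc k) (w i) = 0" "w i < b" if "i \<le> n - Suc k" for i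
    proof -
      have "i < n - k" "i \<le> n - k" "Suc i \<le> n - k" using that Suc.prems(5) by auto
      from w[OF this(1)] y(2)[OF this(2)] y(2)[OF this(3)]
      show "w i \<in> {a..b} \<and> F (Suc k) (w i) = 0" "w i < b" by auto
    qed
  qed
qed

section \<open>Newton's backward interpolation and the coefficients
  \<open>diff_coeff\<close>\<close>

primrec backward_difference :: "nat \<Rightarrow> (real \<Rightarrow> real) \<Rightarrow> real \<Rightarrow> real" where
  "backward_difference 0 g x = g x"
| "backward_difference (Suc j) g x = backward_difference j g x - backward_difference j g (x - 1)"

definition newton_poly :: "nat \<Rightarrow> real poly" where
  "newton_poly j = smult (1 / fact j) (pochhammer [:0, 1:] j)"

lemma newton_poly_0: "newton_poly 0 = 1"
  by (simp add: newton_poly_def)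

lemma newton_poly_Suc:
  "newton_poly (Suc j) = smult (1 / real (Suc j)) ([:real j, 1:] * newton_poly j)"
  by (simp add: newton_poly_def pochhammer_rec' of_nat_poly field_simps)

lemma poly_newton_poly: "poly (newton_poly j) s = pochhammer s j / fact j"
  by (simp add: newton_poly_def pochhammer_prod poly_prod)

text \<open>Both values of the polynomial of degree \<open>j + 1\<close> share the factor
  \<open>pochhammer s j\<close>; the remaining factors \<open>s + j\<close> and \<open>s - 1\<close>
  differ by \<open>j + 1\<close>, which cancels against the factorial.\<close>

lemma poly_newton_poly_shift:
  "poly (newton_poly (Suc j)) (s - 1) = poly (newton_poly (Suc j)) s - poly (newton_poly j) s"
  unfolding poly_newton_poly pochhammer_rec'[of s] pochhammer_rec[of "s - 1"]
  by (simp add: divide_simps) (simp add: algebra_simps)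

lemma poly_newton_poly_eq_0: "l < j \<Longrightarrow> poly (newton_poly j) (- real l) = 0"
  by (simp add: poly_newton_poly pochhammer_of_nat_eq_0_iff)

lemma degree_newton_poly: "degree (newton_poly j) = j"
proof -
  have "degree (newton_poly j) = j \<and> newton_poly j \<noteq> 0"
    by (induction j) (simp_all add: newton_poly_0 newton_poly_Suc degree_mult_eq del: mult_pCons_left)
  then show ?thesis ..
qed

lemma lead_coeff_newton_poly: "coeff (newton_poly j) j = 1 / fact j"
  by (induction j) (simp_all add: newton_poly_0 newton_poly_Suc coeff_eq_0 degree_newton_poly)

text \<open>Comparing coefficients of degree \<open>i + 1\<close> in \<open>newton_poly_Suc\<close>
  and multiplying by \<open>fact (i + 1)\<close> gives exactly the recursion of
  \<open>diff_coeff\<close>.\<close>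

lemma diff_coeff_eq: "diff_coeff i j = fact i * coeff (newton_poly j) i"
proof (induction i j rule: diff_coeff.induct)
  case (4 i j)
  then show ?case
    by (simp add: newton_poly_Suc field_simps)
qed (simp_all add: newton_poly_0 poly_newton_poly pochhammer_0_left flip: poly_0_coeff_0)

text \<open>Induction on the node with \<open>x\<close> free: by the shift identity, evaluating one
  node further left amounts to replacing the differences at \<open>x\<close> by those at
  \<open>x - 1\<close>.\<close>

lemma newton_backward_interpolation:
  assumes "l \<le> m"
  shows "(\<Sum>j\<le>m. backward_difference j g x * poly (newton_poly j) (- real l)) = g (x - real l)"
  using assms
proof (induction l arbitrary: x)
  case 0
  have "poly (newton_poly j) 0 = (if j = 0 then 1 else 0)" for j
    by (simp add: poly_newton_poly pochhammer_0_left)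
  then have "(\<Sum>j\<le>m. backward_difference j g x * poly (newton_poly j) (- real 0))
      = (\<Sum>j\<le>m. if j = 0 then g x else 0)"
    by (intro sum.cong) auto
  then show ?case by simp
next
  case (Suc l)
  let ?N = "\<lambda>j. poly (newton_poly j) (- real l)"
  let ?B = "\<lambda>j. backward_difference j g x"
  obtain m' where m: "m = Suc m'" using Suc.prems by (cases m) auto
  have shift: "poly (newton_poly (Suc j)) (- real (Suc l)) = ?N (Suc j) - ?N j" for j
  proof -
    have "- real (Suc l) = - real l - 1" by simp
    then show ?thesis by (simp only: poly_newton_poly_shift)
  qed
  have "(\<Sum>j\<le>m. ?B j * poly (newton_poly j) (- real (Suc l)))
      = ?B 0 + (\<Sum>j\<le>m'. ?B (Suc j) * (?N (Suc j) - ?N j))"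
    unfolding m sum.atMost_Suc_shift shift by (simp add: newton_poly_0)
  also have "\<dots> = (\<Sum>j\<le>m. ?B j * ?N j) - (\<Sum>j\<le>m'. ?B (Suc j) * ?N j)"
    unfolding m sum.atMost_Suc_shift[of _ m']
    by (simp add: newton_poly_0 right_diff_distrib sum_subtractf)
  \<comment> \<open>The added term \<open>j = m\<close> vanishes because \<open>l < m\<close>. Then
    \<open>?B j - ?B (Suc j)\<close> is the difference of order \<open>j\<close> at
    \<open>x - 1\<close>.\<close>
  also have "(\<Sum>j\<le>m'. ?B (Suc j) * ?N j) = (\<Sum>j\<le>m. ?B (Suc j) * ?N j)"
    using poly_newton_poly_eq_0[of l m] Suc.prems by (simp add: m)
  also have "(\<Sum>j\<le>m. ?B j * ?N j) - \<dots>
      = (\<Sum>j\<le>m. backward_difference j g (x - 1) * ?N j)"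
    by (simp add: sum_subtractf[symmetric] algebra_simps)
  also have "\<dots> = g (x - real (Suc l))"
    using Suc.IH[of "x - 1"] Suc.prems by (simp add: algebra_simps)
  finally show ?case .
qed

lemma diff_coeff_eq_0: "j < i \<Longrightarrow> diff_coeff i j = 0"
  by (simp add: diff_coeff_eq coeff_eq_0 degree_newton_poly)

text \<open>Both terms of the recursion are nonnegative. The second is positive, except for first
  index \<open>1\<close> and \<open>j > 0\<close>, where \<open>diff_coeff 0 j = 0\<close> and the
  first term takes over. Positivity permits division by \<open>diff_coeff i (m + 1)\<close>
  below.\<close>

lemma diff_coeff_pos: "1 \<le> i \<Longrightarrow> i \<le> j \<Longrightarrow> diff_coeff i j > 0"
proof (induction i j rule: diff_coeff.induct)
  case (4 i j)
  have nonneg: "diff_coeff (Suc i) j \<ge> 0"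
    using "4.IH"(1) diff_coeff_eq_0[of j "Suc i"] by (cases "Suc i \<le> j") auto
  show ?case
  proof (cases i)
    case 0
    have "diff_coeff (Suc 0) j > 0" if "j \<noteq> 0" using "4.IH"(1) that 0 by simp
    moreover have "diff_coeff 0 j = 0" if "j \<noteq> 0" using that by (cases j) auto
    ultimately show ?thesis using 0 by (cases "j = 0") auto
  next
    case (Suc i')
    then have "diff_coeff i j > 0" using "4.IH"(2) "4.prems" by simp
    then have "real (Suc i) * diff_coeff i j > 0" by simp
    moreover have "real j * diff_coeff (Suc i) j \<ge> 0" using nonneg by simp
    ultimately show ?thesis by (simp only: diff_coeff.simps) (simp add: add_nonneg_pos)
  qed
qed simp_all

section \<open>Error of numerical differentiation by backward differences\<close>

text \<open>\<open>G n\<close> stands for the derivative of order \<open>n\<close> of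
  \<open>G 0\<close>. The factor \<open>c\<close> is a chord slope of \<open>G m\<close>, not a
  value of a further derivative, since \<open>G m\<close> is in general only Lipschitz in the
  application.\<close>

lemma backward_difference_error:
  fixes G :: "nat \<Rightarrow> real \<Rightarrow> real"
  assumes i: "1 \<le> i" "i \<le> m"
    and deriv: "\<And>n s. n < m \<Longrightarrow> s \<in> {x - real m..x} \<Longrightarrow>
      (G n has_real_derivative G (Suc n) s) (at s within {x - real m..x})"
  obtains a b c where "x - real m \<le> a" "a < b" "b \<le> x"
    and "G m b - G m a = c * (b - a)"
    and "G i x - (\<Sum>j=i..m. diff_coeff i j * backward_difference j (G 0) x)
      = c * diff_coeff i (m + 1)"
proof -
  let ?I = "{x - real m..x}"
  have pos: "diff_coeff i (m + 1) > 0"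
    using i by (intro diff_coeff_pos) auto
  define S where "S = (\<Sum>j=i..m. diff_coeff i j * backward_difference j (G 0) x)"
  \<comment> \<open>Solves \<open>E i x = 0\<close> for the \<open>E\<close> below, as the
    derivative of order \<open>i\<close> of \<open>newton_poly (m + 1)\<close> at \<open>0\<close>
    is \<open>diff_coeff i (m + 1)\<close>.\<close>
  define c where "c = (G i x - S) / diff_coeff i (m + 1)"
  define P where "P = (\<Sum>j\<le>m. smult (backward_difference j (G 0) x) (newton_poly j))"
  define Q where "Q = P + smult c (newton_poly (Suc m))"
  define E where "E n s = G n s - poly ((pderiv ^^ n) Q) (s - x)" for n s
  have E_deriv: "(E n has_real_derivative E (Suc n) s) (at s within ?I)" if "n < m" "s \<in> ?I" for n s
    unfolding E_def using deriv[OF that]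
    by (auto intro!: derivative_eq_intros DERIV_chain2[OF poly_DERIV])
  have E_0: "E 0 (x - real l) = 0" if "l \<le> m" for l
    using newton_backward_interpolation[OF that, of "G 0" x] poly_newton_poly_eq_0[of l "Suc m"] that
    by (simp add: E_def Q_def P_def poly_sum)
  have "poly ((pderiv ^^ i) Q) 0 = fact i * coeff Q i"
    by (simp add: poly_0_coeff_0 coeff_higher_pderiv pochhammer_fact)
  also have "\<dots> = (\<Sum>j\<le>m. backward_difference j (G 0) x * diff_coeff i j) + c * diff_coeff i (m + 1)"
    by (simp add: Q_def P_def coeff_sum diff_coeff_eq sum_distrib_left algebra_simps)
  also have "(\<Sum>j\<le>m. backward_difference j (G 0) x * diff_coeff i j) = S"
    unfolding S_def by (rule sum.mono_neutral_cong_right) (auto simp: diff_coeff_eq_0)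
  also have "S + c * diff_coeff i (m + 1) = G i x"
    using pos by (simp add: c_def)
  finally have E_i: "E i x = 0" by (simp add: E_def)
  obtain y where y: "\<And>j. j < m - i \<Longrightarrow> y j < y (Suc j)"
    "\<And>j. j \<le> m - i \<Longrightarrow> y j \<in> ?I \<and> E i (y j) = 0" "\<And>j. j \<le> m - i \<Longrightarrow> y j < x"
  \<comment> \<open>The nodes \<open>x - l\<close> are listed from left to right, hence the reversed
    index \<open>m - j\<close>.\<close>
  proof (rule iterated_Rolle[of i "x - real m" x E m "\<lambda>j. x - real (m - j)"])
    show "x - real (m - j) \<in> ?I \<and> E 0 (x - real (m - j)) = 0" if "j \<le> m" for j
      using that E_0[of "m - j"] by auto
  qed (use i E_deriv in auto)
  \<comment> \<open>Appending \<open>x\<close>, a zero of \<open>E i\<close> by the choice of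
    \<open>c\<close>, yields \<open>m - i + 2\<close> zeros, so that two survive
    \<open>m - i\<close> further applications of Rolle's theorem.\<close>
  define y' where "y' j = (if j \<le> m - i then y j else x)" for j
  obtain w where w: "\<And>j. j < Suc (m - i) - (m - i) \<Longrightarrow> w j < w (Suc j)"
    "\<And>j. j \<le> Suc (m - i) - (m - i) \<Longrightarrow> w j \<in> ?I \<and> E (i + (m - i)) (w j) = 0"
  proof (rule iterated_Rolle[of "m - i" "x - real m" x "\<lambda>j. E (i + j)" "Suc (m - i)" y'])
    show "y' j < y' (Suc j)" if "j < Suc (m - i)" for j
      using that y by (auto simp: y'_def)
    show "y' j \<in> ?I \<and> E (i + 0) (y' j) = 0" if "j \<le> Suc (m - i)" for j
      using that y E_i by (auto simp: y'_def)
  qed (use i E_deriv in auto)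
  have w': "w 0 < w 1" "w 0 \<in> ?I" "w 1 \<in> ?I" "E m (w 0) = 0" "E m (w 1) = 0"
    using w(1)[of 0] w(2)[of 0] w(2)[of 1] i by auto
  define R where "R = (pderiv ^^ m) Q"
  have degQ: "degree Q \<le> Suc m"
    unfolding Q_def P_def
    by (intro degree_add_le degree_sum_le order.trans[OF degree_smult_le])
       (auto simp: degree_newton_poly)
  \<comment> \<open>\<open>P\<close> has degree at most \<open>m\<close>, so only the term with
    \<open>c\<close> contributes. Differentiating \<open>m\<close> times multiplies this coefficient
    by \<open>(m + 1)!\<close>, which leaves slope \<open>c\<close>.\<close>
  have coeffQ: "coeff Q (Suc m) = c / fact (Suc m)"
    unfolding Q_def P_def
    by (auto simp: coeff_sum lead_coeff_newton_poly degree_newton_poly coeff_eq_0 intro!: sum.neutral)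
  have "degree R \<le> 1"
    unfolding R_def degree_higher_pderiv using degQ by simp
  then have "R = [:coeff R 0, coeff R 1:]"
    by (intro poly_eqI) (auto simp: coeff_pCons coeff_eq_0 split: nat.split)
  then have R: "poly R s = coeff R 0 + coeff R 1 * s" for s
    by (metis poly_pCons poly_0 mult.commute mult_zero_right add_0_right)
  have "coeff R 1 = pochhammer 2 m * coeff Q (Suc m)"
    by (simp add: R_def coeff_higher_pderiv)
  also have "pochhammer (2::real) m = fact (Suc m)"
    by (metis pochhammer_fact pochhammer_rec mult_1 one_add_one)
  finally have "coeff R 1 = c" by (simp add: coeffQ)
  moreover have "G m (w j) = coeff R 0 + coeff R 1 * (w j - x)" if "E m (w j) = 0" for j
    using that R by (simp add: E_def R_def)
  ultimately have "G m (w 1) - G m (w 0) = c * (w 1 - w 0)"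
    using w'(4,5) by (simp add: right_diff_distrib)
  moreover have "G i x - S = c * diff_coeff i (m + 1)"
    using pos by (simp add: c_def)
  ultimately show ?thesis
    using w' that[of "w 0" "w 1" c] by (auto simp: S_def)
qed

section \<open>Derivatives on the half-line\<close>

lemma nth_deriv_has_real_derivative:
  assumes "nth_deriv n f differentiable_on {0..}" "t \<ge> 0"
  shows "(nth_deriv n f has_real_derivative nth_deriv (Suc n) f t) (at t within {0..})"
  using assms by (simp add: differentiable_on_def vector_derivative_works
      has_real_derivative_iff_has_vector_derivative)

text \<open>Identifies \<open>nth_deriv\<close> from an explicit chain of derivatives. It serves for
  the monomial, where equality is to be shown.\<close>

lemma nth_deriv_eqI:
  assumes "\<And>t. t \<ge> 0 \<Longrightarrow> H 0 t = f t"
    and "\<And>n t. n < m \<Longrightarrow> t \<ge> 0 \<Longrightarrow> (H n has_real_derivative H (Suc n) t) (at t within {0..})"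
    and "n \<le> m" "t \<ge> 0"
  shows "nth_deriv n f t = H n t"
  using assms(3,4)
proof (induction n arbitrary: t)
  case 0
  then show ?case using assms(1) by simp
next
  case (Suc n)
  have "(nth_deriv n f has_vector_derivative H (Suc n) t) (at t within {0..})"
    unfolding has_real_derivative_iff_has_vector_derivative[symmetric]
    using Suc assms(2)[of n t]
    by (intro has_field_derivative_transform_within[of "H n" _ t "{0..}" 1 "nth_deriv n f"]) auto
  \<comment> \<open>Every \<open>t \<ge> 0\<close>, including \<open>0\<close>, is a limit point of
    the half-line, so the derivative is unique.\<close>
  moreover have "at t within {0..} \<noteq> bot"
    using islimpt_subset[of t "{t..t + 1}" "{0..}"] Suc.prems
    by (simp add: trivial_limit_within)
  ultimately show ?case by (simp add: vector_derivative_within)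
qed

section \<open>The differentiator in sliding mode\<close>

text \<open>In sliding mode the signed powers vanish, and the implicit relation reads
  \<open>T * z (j + 2) (k + 1) = z (j + 1) (k + 1) - z (j + 1) k\<close>. Each order looks one step
  further back, hence \<open>k \<ge> K + j\<close>.\<close>

lemma sliding_state_backward_difference:
  assumes traj: "ired_trajectory m T L lam u z"
    and "T \<noteq> 0" "K \<ge> 1"
    and sliding: "\<And>k. k \<ge> K \<Longrightarrow> z 1 (k + 1) = u k \<and> u k = g (real k)"
    and "j \<le> m" "k \<ge> K + j"
  shows "T ^ j * z (j + 1) (k + 1) = backward_difference j g (real k)"
  using \<open>j \<le> m\<close> \<open>k \<ge> K + j\<close>
proof (induction j arbitrary: k)
  case 0
  then show ?case using sliding by simp
next
  case (Suc j)
  have "k \<ge> 1" "j + 1 \<in> {1..m}" using Suc.prems by auto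
  with traj have "z (j + 1) (k + 1) = z (j + 1) k
      + T * lam (j + 1) * L powr (real (j + 1) / real (m + 1))
          * signed_pow (u k - z 1 (k + 1)) (real (m - (j + 1) + 1) / real (m + 1))
      + T * z (j + 1 + 1) (k + 1)"
    unfolding ired_trajectory_def by blast
  moreover have "signed_pow (u k - z 1 (k + 1)) p = 0" for p
    using sliding[of k] Suc.prems by (simp add: signed_pow_def)
  ultimately have "z (j + 1) (k + 1) = z (j + 1) k + T * z (j + 2) (k + 1)"
    by simp
  then have "T ^ Suc j * z (Suc j + 1) (k + 1) = T ^ j * z (j + 1) (k + 1) - T ^ j * z (j + 1) (k - 1 + 1)"
    using Suc.prems by (simp add: algebra_simps)
  also have "\<dots> = backward_difference (Suc j) g (real k)"
    using Suc.IH[of k] Suc.IH[of "k - 1"] Suc.prems by (simp add: of_nat_diff)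
  finally show ?case .
qed

text \<open>This is \<open>backward_difference_error\<close> in the variable
  \<open>s = t / T\<close>, in which the sampling times are integers; the result is then scaled
  back.\<close>

lemma sliding_output_error:
  assumes traj: "ired_trajectory m T L lam u z"
    and T: "T > 0" and K: "K \<ge> 1"
    and sliding: "\<And>k. k \<ge> K \<Longrightarrow> z 1 (k + 1) = u k \<and> u k = f (real k * T)"
    and deriv: "\<And>n t. n < m \<Longrightarrow> t \<ge> 0 \<Longrightarrow>
      (nth_deriv n f has_real_derivative nth_deriv (Suc n) f t) (at t within {0..})"
    and i: "i \<in> {1..m}" and k: "k \<ge> K + m"
  obtains a b c where "0 \<le> a" "a < b"
    and "nth_deriv m f b - nth_deriv m f a = c * (b - a)"
    and "nth_deriv i f (real k * T) - ired_output m T z i k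
      = c * (diff_coeff i (m + 1) * T ^ (m - i + 1))"
proof -
  \<comment> \<open>By the chain rule, the derivative of order \<open>n\<close> of
    \<open>f (s * T)\<close> with respect to \<open>s\<close>.\<close>
  define G where "G n s = T ^ n * nth_deriv n f (s * T)" for n s
  have km: "real k - real m \<ge> 0" using k by simp
  have G: "(G n has_real_derivative G (Suc n) s) (at s within {real k - real m..real k})"
    if "n < m" "s \<in> {real k - real m..real k}" for n s
  proof -
    have "((\<lambda>s. nth_deriv n f (s * T)) has_real_derivative nth_deriv (Suc n) f (s * T) * T)
        (at s within {real k - real m..real k})"
    proof -
      have "(\<lambda>s. s * T) ` {real k - real m..real k} \<subseteq> {0..}"
        using km T by auto
      moreover have "s * T \<ge> 0" using that km T by simp
      ultimately have "(nth_deriv n f has_real_derivative nth_deriv (Suc n) f (s * T))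
          (at (s * T) within (\<lambda>s. s * T) ` {real k - real m..real k})"
        using deriv[of n "s * T"] \<open>n < m\<close> by (metis DERIV_subset)
      moreover have "((\<lambda>s. s * T) has_real_derivative T) (at s within {real k - real m..real k})"
        by (auto intro!: derivative_eq_intros)
      ultimately show ?thesis
        using DERIV_image_chain[of "nth_deriv n f" _ "\<lambda>s. s * T"] by (simp add: o_def)
    qed
    from DERIV_cmult[OF this, of "T ^ n"] show ?thesis
      unfolding G_def by (simp add: mult_ac)
  qed
  obtain a b c where ab: "real k - real m \<le> a" "a < b"
    and Gm: "G m b - G m a = c * (b - a)"
    and Gi: "G i (real k) - (\<Sum>j=i..m. diff_coeff i j * backward_difference j (G 0) (real k))
      = c * diff_coeff i (m + 1)"
    by (rule backward_difference_error[of i m "real k" G]) (use i G in auto)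
  have "backward_difference j (G 0) (real k) = T ^ i * (T ^ (j - i) * z (j + 1) (k + 1))"
    if "j \<in> {i..m}" for j
    using sliding_state_backward_difference[OF traj _ K, of "G 0" j k] sliding T k that
    by (simp add: G_def power_add[symmetric] mult.assoc[symmetric])
  then have "(\<Sum>j=i..m. diff_coeff i j * backward_difference j (G 0) (real k))
      = T ^ i * ired_output m T z i k"
    unfolding ired_output_def sum_distrib_left by (intro sum.cong) auto
  with Gi have "T ^ i * (nth_deriv i f (real k * T) - ired_output m T z i k) = c * diff_coeff i (m + 1)"
    by (simp add: G_def algebra_simps)
  moreover have "T ^ (m + 1) = T ^ i * T ^ (m - i + 1)"
    using i by (simp flip: power_add)
  \<comment> \<open>Returning to time divides the slope by \<open>T ^ (m + 1)\<close>:
    \<open>m\<close> factors come from the derivatives and one from the length of the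
    interval.\<close>
  ultimately have "nth_deriv i f (real k * T) - ired_output m T z i k
      = c / T ^ (m + 1) * (diff_coeff i (m + 1) * T ^ (m - i + 1))"
    using T by (simp add: field_simps)
  moreover have "nth_deriv m f (b * T) - nth_deriv m f (a * T) = c / T ^ (m + 1) * (b * T - a * T)"
  proof -
    have "T ^ m * (nth_deriv m f (b * T) - nth_deriv m f (a * T)) = c * (b - a)"
      using Gm by (simp add: G_def right_diff_distrib)
    then have "nth_deriv m f (b * T) - nth_deriv m f (a * T) = c * (b - a) / T ^ m"
      using T by (simp add: eq_divide_eq mult.commute)
    also have "\<dots> = c / T ^ (m + 1) * (b * T - a * T)"
      using T by (simp flip: left_diff_distrib)
    finally show ?thesis .
  qed
  moreover have "0 \<le> a * T" "a * T < b * T"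
    using ab km T by auto
  ultimately show ?thesis using that by blast
qed

section \<open>Regularity of the signal class\<close>

lemma signal_class_imp_has_derivative:
  assumes "f \<in> signal_class m M" "n < m" "t \<ge> 0"
  shows "(nth_deriv n f has_real_derivative nth_deriv (Suc n) f t) (at t within {0..})"
  using assms by (intro nth_deriv_has_real_derivative) (auto simp: signal_class_def)

text \<open>Improves the unspecified Lipschitz constant of the signal class to \<open>M\<close>, by
  the mean value inequality above.\<close>

lemma signal_class_imp_nth_deriv_lipschitz:
  assumes "f \<in> signal_class m M" "0 \<le> a" "a \<le> b"
  shows "\<bar>nth_deriv m f b - nth_deriv m f a\<bar> \<le> M * (b - a)"
proof -
  obtain C where "C-lipschitz_on {0..} (nth_deriv m f)"
    using assms(1) by (auto simp: signal_class_def)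
  then have "C-lipschitz_on {a..b} (nth_deriv m f)"
    using assms(2) by (auto intro: lipschitz_on_subset)
  moreover have "AE t in lborel. t \<ge> 0 \<longrightarrow> nth_deriv m f differentiable (at t within {0..}) \<and>
      \<bar>nth_deriv (Suc m) f t\<bar> \<le> M"
    using assms(1) by (simp add: signal_class_def)
  then have "AE t in lborel. t \<in> {a..b} \<longrightarrow>
      (\<exists>D. (nth_deriv m f has_vector_derivative D) (at t within {a..b}) \<and> norm D \<le> M)"
  proof eventually_elim
    case (elim t)
    show ?case
    proof
      assume t: "t \<in> {a..b}"
      with elim assms(2) have "(nth_deriv m f has_vector_derivative nth_deriv (Suc m) f t) (at t within {0..})"
        by (simp add: vector_derivative_works)
      then have "(nth_deriv m f has_vector_derivative nth_deriv (Suc m) f t) (at t within {a..b})"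
        by (rule has_vector_derivative_within_subset) (use assms(2) in auto)
      then show "\<exists>D. (nth_deriv m f has_vector_derivative D) (at t within {a..b}) \<and> norm D \<le> M"
        using elim t assms(2) by (intro exI[of _ "nth_deriv (Suc m) f t"]) simp
    qed
  qed
  ultimately show ?thesis
    using lipschitz_AE_derivative_bound[of a b C "nth_deriv m f" M] assms(3) by simp
qed

section \<open>The error bound and its attainment by the monomial\<close>

theorem theorem3p5:
  fixes m K :: nat and L T M :: real and lam :: "nat \<Rightarrow> real"
    and f :: "real \<Rightarrow> real" and \<eta> u :: "nat \<Rightarrow> real" and z :: "nat \<Rightarrow> nat \<Rightarrow> real"
  assumes "m \<ge> 1" and "L > 0" and "T > 0"
    and "\<And>i. i \<in> {1..m + 1} \<Longrightarrow> lam i > 0"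
    and "0 \<le> M" and "M \<le> L"
    and "\<And>k. k \<ge> 1 \<Longrightarrow> u k = f (real k * T) + \<eta> k"
    and "ired_trajectory m T L lam u z"
    and "K \<ge> 1"
    and "\<And>k. k \<ge> K \<Longrightarrow> \<eta> k = 0 \<and> sliding_mode m T L lam u z k"
  shows "(f \<in> signal_class m M \<longrightarrow>
            (\<forall>i\<in>{1..m}. \<forall>k\<ge>K + m + 1.
               \<bar>ired_output m T z i k - nth_deriv i f (real k * T)\<bar>
                 \<le> diff_coeff i (m + 1) * M * T ^ (m - i + 1))) \<and>
         ((\<forall>t\<ge>0. f t = M * t ^ (m + 1) / fact (m + 1)) \<longrightarrow>
            (\<forall>i\<in>{1..m}. \<forall>k\<ge>K + m + 1.
               \<bar>ired_output m T z i k - nth_deriv i f (real k * T)\<bar>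
                 = diff_coeff i (m + 1) * M * T ^ (m - i + 1)))"
proof (intro conjI impI ballI allI)
  have sliding: "z 1 (k + 1) = u k \<and> u k = f (real k * T)" if "k \<ge> K" for k
    using assms(10)[OF that] assms(7)[of k] assms(9) that
      sliding_mode_iff[of T L lam m u z k] assms(2,3,4) by auto
  note error = sliding_output_error[OF assms(8,3,9) sliding]
  fix i k assume i: "i \<in> {1..m}" and k: "k \<ge> K + m + 1"
  have cT: "diff_coeff i (m + 1) * T ^ (m - i + 1) \<ge> 0"
    using diff_coeff_pos[of i "m + 1"] i assms(3) by simp
  {
    assume f: "f \<in> signal_class m M"
    obtain a b c where "0 \<le> a" "a < b"
      and c: "nth_deriv m f b - nth_deriv m f a = c * (b - a)"
      and err: "nth_deriv i f (real k * T) - ired_output m T z i k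
        = c * (diff_coeff i (m + 1) * T ^ (m - i + 1))"
      using error[OF _ signal_class_imp_has_derivative[OF f] i, of k] k by auto
    \<comment> \<open>\<open>c\<close> is a difference quotient of a function with Lipschitz
      constant \<open>M\<close>.\<close>
    then have "\<bar>c\<bar> \<le> M"
      using signal_class_imp_nth_deriv_lipschitz[OF f, of a b] by (simp add: abs_mult)
    then have "\<bar>c * (diff_coeff i (m + 1) * T ^ (m - i + 1))\<bar>
        \<le> M * (diff_coeff i (m + 1) * T ^ (m - i + 1))"
      using abs_mult_pos[OF cT, of c] mult_right_mono[OF _ cT, of "\<bar>c\<bar>" M] by simp
    then show "\<bar>ired_output m T z i k - nth_deriv i f (real k * T)\<bar>
        \<le> diff_coeff i (m + 1) * M * T ^ (m - i + 1)"
      unfolding err[symmetric] by (simp add: abs_minus_commute mult_ac)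
  }
  {
    assume f: "\<forall>t\<ge>0. f t = M * t ^ (m + 1) / fact (m + 1)"
    \<comment> \<open>The successive derivatives of the monomial. \<open>H m t\<close> is
      \<open>M * t\<close>, so every chord slope of it equals \<open>M\<close>, which forces
      \<open>c = M\<close> below.\<close>
    define H where "H n t = M * t ^ (m + 1 - n) / fact (m + 1 - n)" for n and t :: real
    have H: "(H n has_real_derivative H (Suc n) t) (at t within S)" if "n < m" for n t S
    proof -
      have "m + 1 - n = Suc (m - n)" "m + 1 - Suc n = m - n" using that by auto
      moreover have "M * (real (Suc p) * t ^ (Suc p - Suc 0)) / fact (Suc p) = M * t ^ p / fact p" for p
        by (simp add: divide_simps)
      ultimately show ?thesis
        unfolding H_def using DERIV_cdivide[OF DERIV_cmult[OF DERIV_pow[of "Suc (m - n)" t S]]]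
        by metis
    qed
    have nth: "nth_deriv n f t = H n t" if "n \<le> m" "t \<ge> 0" for n t
    proof (rule nth_deriv_eqI[of H f m])
      show "H 0 t = f t" if "t \<ge> 0" for t
        using f that by (simp add: H_def)
    qed (use H that in simp_all)
    have "(nth_deriv n f has_real_derivative nth_deriv (Suc n) f t) (at t within {0..})"
      if "n < m" "t \<ge> 0" for n t
      using has_field_derivative_transform_within[of "H n" _ t "{0..}" 1 "nth_deriv n f"] that
        H[of n t "{0..}"] nth[of "Suc n" t] nth[of n]
      by (simp del: nth_deriv.simps)
    from error[OF _ this i, of k] obtain a b c where ab: "0 \<le> a" "a < b"
      and c: "nth_deriv m f b - nth_deriv m f a = c * (b - a)"
      and err: "nth_deriv i f (real k * T) - ired_output m T z i k
        = c * (diff_coeff i (m + 1) * T ^ (m - i + 1))"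
      using k by auto
    have "c = M" using ab c by (simp add: nth H_def flip: right_diff_distrib)
    with cT assms(5) have "\<bar>nth_deriv i f (real k * T) - ired_output m T z i k\<bar>
        = M * (diff_coeff i (m + 1) * T ^ (m - i + 1))"
      unfolding err by (simp only: abs_of_nonneg mult_nonneg_nonneg)
    then show "\<bar>ired_output m T z i k - nth_deriv i f (real k * T)\<bar>
        = diff_coeff i (m + 1) * M * T ^ (m - i + 1)"
      by (simp add: abs_minus_commute mult_ac)
  }
qed

end
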